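(* Let $P$ be an $N\times N$ real matrix with non-negative entries and $\rho(P)=1$, assume there is a strictly positive vector $V$ with $V^TP=V^T$, and let $B\in\mathbb{R}^N$ satisfy $\sum_{i}v_iB_i=0$. Let $H$ be the limit of the sequential single-processor D-iteration for $(P,B)$ along a fair sequence of selected nodes in which only negative fluid is diffused (this limit being assumed to exist). Consider the two-processor asynchronous distributed D-iteration for $(P,B)$ described in the context, in which only negative fluids are diffused. Suppose each processor (PID) applies a fair sequence for diffusions, and suppose there is a constant $T$ such that, for the transmissions in both directions and for all $n\ge1$, $|T_n-T_n'|\le T$ and $|T_n'-T_{n-1}'|\le T$. Then the distributed computation converges to $H$: writing $H=([H]^1,[H]^2)$ according to $\Omega=\Omega_1\cup\Omega_2$, one has $H^1_n\to[H]^1$ and $H^2_n\to[H]^2$ as $n\to\infty$.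
   Context: Let $I$ be the identity matrix and $J_i$ the matrix whose only non-zero entry is $(J_i)_{ii}=1$. Sequential D-iteration with negative diffusion: a sequence of selected nodes $i_1,i_2,\dots$ in $\Omega=\{1,\dots,N\}$ is given, fair in the sense that each node is selected infinitely often. Set $F_0=B$, $H_0=0$. At step $n\ge1$, if $(F_{n-1})_{i_n}<0$ then $F_n=(I-J_{i_n}+PJ_{i_n})F_{n-1}$ and $H_n=H_{n-1}+J_{i_n}F_{n-1}$; otherwise $F_n=F_{n-1}$, $H_n=H_{n-1}$. Distributed D-iteration with negative diffusion: fix a partition $\Omega=\Omega_1\cup\Omega_2$ and decompose accordingly $P=\begin{pmatrix}P_{11}&P_{12}\\P_{21}&P_{22}\end{pmatrix}$, $B=(B_1,B_2)$. Processor PID$_j$ ($j=1,2$) maintains vectors $F^j_n,H^j_n\in\mathbb{R}^{\Omega_j}$ indexed by a common discrete time $n=0,1,2,\dots$, with $F^j_0=B_j$, $H^j_0=0$. For each ordered pair (sender $k$, receiver $j$), $k\neq j$, there are sending times $0=T_0'<T_1'<T_2'<\cdots$ and receiving times $T_n\ge T_n'$ (integers, $n\ge1$; these times may be different for the two directions, and messages need not arrive in the order sent). The $n$-th message is $P_{jk}(H^k_{T_n'}-H^k_{T_{n-1}'})$, received by PID$_j$ at time $T_n$. Let $G^k_m$ be the sum of the messages from PID$_k$ received by PID$_j$ at time $m$ ($0$ if none). At each time step $n\ge1$, PID$_j$ forms $\tilde F=F^j_{n-1}+G^k_{n-1}$ and either is idle or selects a node $i=i_n^j\in\Omega_j$ from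 a sequence fixed in advance; if a node $i$ is selected and $\tilde F_i<0$, then $F^j_n=(I-J_i+P_{jj}J_i)\tilde F$ and $H^j_n=H^j_{n-1}+J_i\tilde F$; otherwise $F^j_n=\tilde F$ and $H^j_n=H^j_{n-1}$. PID$_j$ applies a fair sequence if every node of $\Omega_j$ is selected infinitely often. *)

theory Defs
  imports "HOL-Analysis.Analysis" "Jordan_Normal_Form.Spectral_Radius"
begin

no_notation vec_index (infixl \<open>$\<close> 100)
no_notation scalar_prod (infix \<open>\<bullet>\<close> 70)
hide_const (open) Matrix.mat Matrix.vec Matrix.row Matrix.col

(* The spectral radius available for complex matrices is stated for the matrix type indexed by
   {0..<N} * {0..<N}, so the index type is enumerated by from_nat_into UNIV, which is a bijection
   from {..<CARD('n)}.  Another enumeration gives a permutation-similar matrix with the same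
   spectrum. *)
definition spec_rad :: "real ^ 'n ^ 'n \<Rightarrow> real" where
  "spec_rad A = spectral_radius (Matrix.mat CARD('n) CARD('n)
     (\<lambda>(i, j). complex_of_real
        (A $ from_nat_into (UNIV :: 'n set) i $ from_nat_into (UNIV :: 'n set) j)))"

definition J :: "'n \<Rightarrow> real ^ 'n ^ 'n" where
  "J i = (\<chi> a b. if a = i \<and> b = i then 1 else 0)"

(* One negative diffusion attempt at node i, on a pair (fluid, history). *)
definition diffuse ::
  "real ^ 'n ^ 'n \<Rightarrow> 'n \<Rightarrow> (real ^ 'n) \<times> (real ^ 'n) \<Rightarrow> (real ^ 'n) \<times> (real ^ 'n)" where
  "diffuse Q i = (\<lambda>(F, H).
     if F $ i < 0 then ((mat 1 - J i + Q ** J i) *v F, H + J i *v F) else (F, H))"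

(* The pair (F_n, H_n); the node used at step n >= 1 is s n, and s 0 is never used. *)
primrec seq_iter ::
  "real ^ 'n ^ 'n \<Rightarrow> real ^ 'n \<Rightarrow> (nat \<Rightarrow> 'n) \<Rightarrow> nat \<Rightarrow> (real ^ 'n) \<times> (real ^ 'n)" where
  "seq_iter P B s 0 = (B, 0)"
| "seq_iter P B s (Suc n) = diffuse P (s (Suc n)) (seq_iter P B s n)"

definition seq_hist ::
  "real ^ 'n ^ 'n \<Rightarrow> real ^ 'n \<Rightarrow> (nat \<Rightarrow> 'n) \<Rightarrow> nat \<Rightarrow> real ^ 'n" where
  "seq_hist P B s n = snd (seq_iter P B s n)"

(* For a subset S of the index type, vectors indexed by S are represented by full vectors that
   vanish outside S; a block of a matrix is likewise padded with zeros. *)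
definition vec_part :: "'n set \<Rightarrow> real ^ 'n \<Rightarrow> real ^ 'n" where
  "vec_part S x = (\<chi> i. if i \<in> S then x $ i else 0)"

definition mat_block :: "real ^ 'n ^ 'n \<Rightarrow> 'n set \<Rightarrow> 'n set \<Rightarrow> real ^ 'n ^ 'n" where
  "mat_block P R C = (\<chi> i j. if i \<in> R \<and> j \<in> C then P $ i $ j else 0)"

datatype pid = PID1 | PID2

primrec other :: "pid \<Rightarrow> pid" where
  "other PID1 = PID2"
| "other PID2 = PID1"

(* Sending times T' and receiving times T are indexed by the receiver j; the sender is other j.
   T j 0 is meaningless. *)
definition transmission_times :: "(nat \<Rightarrow> nat) \<Rightarrow> (nat \<Rightarrow> nat) \<Rightarrow> bool" where
  "transmission_times T' T \<longleftrightarrow> T' 0 = 0 \<and> strict_mono T' \<and> (\<forall>n\<ge>1. T' n \<le> T n)"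

definition message ::
  "real ^ 'n ^ 'n \<Rightarrow> (pid \<Rightarrow> 'n set) \<Rightarrow> (pid \<Rightarrow> nat \<Rightarrow> nat) \<Rightarrow> (pid \<Rightarrow> nat \<Rightarrow> real ^ 'n) \<Rightarrow>
   pid \<Rightarrow> nat \<Rightarrow> real ^ 'n" where
  "message P \<Omega> T' H j n =
     mat_block P (\<Omega> j) (\<Omega> (other j)) *v (H (other j) (T' j n) - H (other j) (T' j (n - 1)))"

(* The sum is finite when transmission_times holds, since then n <= T j n. *)
definition received ::
  "real ^ 'n ^ 'n \<Rightarrow> (pid \<Rightarrow> 'n set) \<Rightarrow> (pid \<Rightarrow> nat \<Rightarrow> nat) \<Rightarrow> (pid \<Rightarrow> nat \<Rightarrow> nat) \<Rightarrow>
   (pid \<Rightarrow> nat \<Rightarrow> real ^ 'n) \<Rightarrow> pid \<Rightarrow> nat \<Rightarrow> real ^ 'n" where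
  "received P \<Omega> T' T H j m = (\<Sum>n | 1 \<le> n \<and> T j n = m. message P \<Omega> T' H j n)"

(* F and H are the trajectories of the distributed iteration; sel j n = None means that processor j
   is idle at step n.  The recursion is stated as a predicate because messages refer to histories
   at arbitrary earlier times; under transmission_times only times up to n are referred to at
   step n + 1, so the trajectories exist and are unique. *)
definition distributed_iter ::
  "real ^ 'n ^ 'n \<Rightarrow> real ^ 'n \<Rightarrow> (pid \<Rightarrow> 'n set) \<Rightarrow> (pid \<Rightarrow> nat \<Rightarrow> nat) \<Rightarrow> (pid \<Rightarrow> nat \<Rightarrow> nat) \<Rightarrow>
   (pid \<Rightarrow> nat \<Rightarrow> 'n option) \<Rightarrow> (pid \<Rightarrow> nat \<Rightarrow> real ^ 'n) \<Rightarrow> (pid \<Rightarrow> nat \<Rightarrow> real ^ 'n) \<Rightarrow> bool" where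
  "distributed_iter P B \<Omega> T' T sel F H \<longleftrightarrow>
     (\<forall>j. F j 0 = vec_part (\<Omega> j) B \<and> H j 0 = 0 \<and>
       (\<forall>n. (F j (Suc n), H j (Suc n)) =
         (let F' = F j n + received P \<Omega> T' T H j n in
          case sel j (Suc n) of
            None \<Rightarrow> (F', H j n)
          | Some i \<Rightarrow> diffuse (mat_block P (\<Omega> j) (\<Omega> j)) i (F', H j n))))"

end

theory Submission
  imports Defs
begin

text \<open>
  The limit is characterised by an extremal property that does not mention the order of the
  diffusions. Fluid is conserved, so when the history is \<open>h\<close> the true residual fluid is
  \<open>B + P *v h - h\<close>, and a negative diffusion at node \<open>i\<close> with the full residual in sight lowers
  \<open>h $ i\<close> exactly to \<open>(B + P *v h) $ i\<close>. Call \<open>Z \<le> 0\<close> a subsolution if \<open>Z \<le> B + P *v Z\<close>.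
  As \<open>P\<close> is nonnegative, \<open>Z \<le> h\<close> implies \<open>Z \<le> B + P *v h\<close>, so the history starts above every
  subsolution (at \<open>0\<close>) and no diffusion takes it below one. Conversely, the limit of a fair
  history is itself a subsolution, since at the limit the residual cannot be negative at a node
  that is visited infinitely often. Hence a limit can only be the greatest subsolution, which
  depends on \<open>P\<close> and \<open>B\<close> alone.

  Delays do not disturb this. Histories only decrease, so every message is nonpositive; fluid that
  is still in transit therefore makes the fluid seen by a processor larger than the true residual,
  its diffusions are more cautious, and the lower bound by subsolutions survives
  (\<open>negative_diffusion_ge_subsolution\<close>). This bound also yields the convergence of the
  distributed history, which is monotone. Every message arrives at some time, so in the limit
  the fluid seen is the true residual (\<open>received_increments_tendsto\<close>) and the limit is a
  subsolution (\<open>negative_diffusion_limit_subsolution\<close>).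

  The relation \<open>negative_diffusion\<close> collects what this argument uses;
  \<open>negative_diffusion_seq_iter\<close> and \<open>negative_diffusion_distributed_iter\<close> show that both
  iterations satisfy it, and \<open>negative_diffusion_limit_unique\<close> compares them.
\<close>

section \<open>Negative diffusions and subsolutions\<close>

lemmas cart_le_def = Finite_Cartesian_Product.less_eq_vec_def
lemmas cart_eq_iff = Finite_Cartesian_Product.vec_eq_iff

text \<open>
  The history is \<open>h\<close>, the set of nodes attempted in the step from \<open>n\<close> to \<open>n + 1\<close> is \<open>A n\<close>, and
  \<open>f n $ i\<close> is the fluid that the processor in charge of \<open>i\<close> sees when it makes this attempt.
  The inequality expresses that the fluid not yet seen is nonpositive, the clause on limits that
  nothing stays unseen for ever. Several nodes may be active in one step, as happens with two
  processors.
\<close>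
definition negative_diffusion ::
  "real ^ 'n ^ 'n \<Rightarrow> real ^ 'n \<Rightarrow> (nat \<Rightarrow> real ^ 'n) \<Rightarrow> (nat \<Rightarrow> real ^ 'n) \<Rightarrow> (nat \<Rightarrow> 'n set) \<Rightarrow> bool" where
  "negative_diffusion P B h f A \<longleftrightarrow>
     h 0 = 0 \<and>
     (\<forall>n i. h (Suc n) $ i = h n $ i + (if i \<in> A n then min 0 (f n $ i) else 0)) \<and>
     (\<forall>n. B + P *v h n - h n \<le> f n) \<and>
     (\<forall>L. h \<longlonglongrightarrow> L \<longrightarrow> f \<longlonglongrightarrow> B + P *v L - L) \<and>
     (\<forall>i. \<exists>\<^sub>\<infinity>n. i \<in> A n)"

definition subsolution :: "real ^ 'n ^ 'n \<Rightarrow> real ^ 'n \<Rightarrow> real ^ 'n \<Rightarrow> bool" where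
  "subsolution P B Z \<longleftrightarrow> Z \<le> 0 \<and> Z \<le> B + P *v Z"

lemma nonneg_matrix_vector_mono:
  fixes P :: "real ^ 'n ^ 'm"
  assumes "\<And>i j. 0 \<le> P $ i $ j" and "x \<le> y"
  shows "P *v x \<le> P *v y"
  using assms
  by (auto simp: cart_le_def matrix_vector_mult_def intro!: sum_mono mult_left_mono)

lemma negative_diffusion_decseq:
  assumes "negative_diffusion P B h f A"
  shows "decseq h"
  by (rule decseq_SucI)
     (use assms in \<open>auto simp: negative_diffusion_def cart_le_def\<close>)

text \<open>
  An active node moves to \<open>h n $ i + f n $ i\<close> or stays. Unseen fluid being nonpositive, its
  value after a move is at least \<open>(B + P *v h n) $ i\<close>, hence at least \<open>(B + P *v Z) $ i\<close> by
  monotonicity of \<open>P\<close>.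
\<close>
lemma negative_diffusion_ge_subsolution:
  assumes P: "\<And>i j. 0 \<le> P $ i $ j" and h: "negative_diffusion P B h f A"
    and Z: "subsolution P B Z"
  shows "Z \<le> h n"
proof (induction n)
  case 0
  show ?case using h Z by (simp add: negative_diffusion_def subsolution_def)
next
  case (Suc n)
  have "Z \<le> B + P *v Z" using Z by (simp add: subsolution_def)
  also have "\<dots> \<le> B + P *v h n"
    using nonneg_matrix_vector_mono[OF P Suc] by (simp add: cart_le_def)
  finally have "Z \<le> B + P *v h n" .
  moreover have "B + P *v h n - h n \<le> f n" using h by (simp add: negative_diffusion_def)
  ultimately have "Z $ i \<le> h n $ i + f n $ i" for i
    by (simp add: cart_le_def) (smt (verit))
  with Suc h show ?case
    by (auto simp: negative_diffusion_def cart_le_def min_def)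
qed

text \<open>
  If the limiting residual were some \<open>c < 0\<close> at a node, every late attempt there would lower the
  history by at least \<open>- c / 2\<close>; by fairness there are infinitely many such attempts, but the
  steps of a convergent history tend to zero.
\<close>
lemma negative_diffusion_limit_subsolution:
  assumes h: "negative_diffusion P B h f A" and L: "h \<longlonglongrightarrow> L"
  shows "subsolution P B L"
proof -
  have "decseq h" using h by (rule negative_diffusion_decseq)
  have "h n \<le> 0" for n
    using decseqD[OF \<open>decseq h\<close>, of 0 n] h by (simp add: negative_diffusion_def)
  then have le0: "L $ i \<le> 0" for i
    by (intro LIMSEQ_le_const2[OF tendsto_vec_nth[OF L]]) (auto simp: cart_le_def)
  have ge: "0 \<le> (B + P *v L - L) $ i" for i
  proof (rule ccontr)
    assume neg: "\<not> 0 \<le> (B + P *v L - L) $ i"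
    have "(\<lambda>n. f n $ i) \<longlonglongrightarrow> (B + P *v L - L) $ i"
      using h L by (intro tendsto_vec_nth) (simp add: negative_diffusion_def)
    then have fneg: "eventually (\<lambda>n. f n $ i < (B + P *v L - L) $ i / 2) sequentially"
      using neg by (intro order_tendstoD) auto
    have "(\<lambda>n. h (Suc n) $ i - h n $ i) \<longlonglongrightarrow> L $ i - L $ i"
      by (intro tendsto_intros LIMSEQ_Suc[OF tendsto_vec_nth[OF L]] tendsto_vec_nth[OF L])
    then have "eventually (\<lambda>n. (B + P *v L - L) $ i / 2 < h (Suc n) $ i - h n $ i) sequentially"
      using neg by (intro order_tendstoD) auto
    with fneg have "eventually (\<lambda>n. i \<notin> A n) sequentially"
    proof eventually_elim
      case (elim n)
      then show ?case using neg h by (auto simp: negative_diffusion_def min_def split: if_splits)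
    qed
    moreover have "\<exists>\<^sub>\<infinity>n. i \<in> A n" using h by (simp add: negative_diffusion_def)
    ultimately show False by (simp add: frequently_def cofinite_eq_sequentially)
  qed
  show ?thesis using le0 ge by (simp add: subsolution_def cart_le_def)
qed

lemma decseq_bounded_below_convergent:
  fixes h :: "nat \<Rightarrow> real ^ 'n"
  assumes "decseq h" and "\<And>n. Z \<le> h n"
  obtains L where "h \<longlonglongrightarrow> L"
proof -
  have "\<exists>l. (\<lambda>n. h n $ i) \<longlonglongrightarrow> l" for i
  proof -
    have dec: "decseq (\<lambda>n. h n $ i)"
      using decseqD[OF assms(1)] unfolding decseq_def cart_le_def by blast
    have "\<forall>n. Z $ i \<le> h n $ i"
      using assms(2) unfolding cart_le_def by blast
    with dec obtain l where "(\<lambda>n. h n $ i) \<longlonglongrightarrow> l" by (rule decseq_convergent)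
    then show ?thesis ..
  qed
  then obtain l where "\<And>i. (\<lambda>n. h n $ i) \<longlonglongrightarrow> l i" by metis
  then have "h \<longlonglongrightarrow> (\<chi> i. l i)" by (intro vec_tendstoI) simp
  then show ?thesis by (rule that)
qed

text \<open>
  Each limit is a subsolution and so bounds the other history from below. The first of these two
  bounds also provides the existence of the second limit.
\<close>
theorem negative_diffusion_limit_unique:
  assumes P: "\<And>i j. 0 \<le> P $ i $ j"
    and h: "negative_diffusion P B h f A" and L: "h \<longlonglongrightarrow> L"
    and h': "negative_diffusion P B h' f' A'"
  shows "h' \<longlonglongrightarrow> L"
proof -
  have "L \<le> h' n" for n
    by (rule negative_diffusion_ge_subsolution[OF P h' negative_diffusion_limit_subsolution[OF h L]])
  then obtain L' where L': "h' \<longlonglongrightarrow> L'"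
    using decseq_bounded_below_convergent negative_diffusion_decseq[OF h'] by blast
  have "L' \<le> h n" for n
    by (rule negative_diffusion_ge_subsolution[OF P h negative_diffusion_limit_subsolution[OF h' L']])
  then have "L' $ i \<le> L $ i" for i
    by (intro LIMSEQ_le_const[OF tendsto_vec_nth[OF L]]) (auto simp: cart_le_def)
  moreover have "L $ i \<le> L' $ i" for i
    using \<open>\<And>n. L \<le> h' n\<close>
    by (intro LIMSEQ_le_const[OF tendsto_vec_nth[OF L']]) (auto simp: cart_le_def)
  ultimately have "L' = L" by (auto simp: cart_eq_iff intro: antisym)
  with L' show ?thesis by simp
qed

section \<open>The sequential iteration\<close>

lemma J_mult_nth: "(J i *v x) $ a = (if a = i then x $ i else 0)"
proof -
  have "(J i *v x) $ a = (\<Sum>b\<in>UNIV. if b = i then if a = i then x $ i else 0 else 0)"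
    unfolding J_def matrix_vector_mult_def vec_lambda_beta
    by (rule sum.cong) auto
  then show ?thesis by simp
qed

lemma snd_diffuse_nth:
  "snd (diffuse Q i (x, y)) $ a = y $ a + (if a = i then min 0 (x $ i) else 0)"
  by (simp add: diffuse_def J_mult_nth min_def)

text \<open>
  Conservation of fluid: a diffusion changes \<open>x + y - Q *v y\<close> in no case. The constant \<open>b\<close> is
  kept arbitrary because in the distributed iteration it grows by the fluid received.
\<close>
lemma diffuse_fluid_balance:
  assumes "diffuse Q i (x, y) = (x', y')" and "x = b + Q *v y - y"
  shows "x' = b + Q *v y' - y'"
proof (cases "x $ i < 0")
  case True
  then have x': "x' = x - J i *v x + Q *v (J i *v x)" and y': "y' = y + J i *v x"
    using assms(1)
    by (auto simp: diffuse_def matrix_vector_mult_add_rdistrib matrix_vector_mult_diff_rdistrib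
        matrix_vector_mul_assoc)
  have "x' - (b + Q *v y' - y') = x - (b + Q *v y - y)"
    unfolding x' y' matrix_vector_right_distrib by simp
  with assms(2) show ?thesis by simp
next
  case False
  with assms(1) have "x' = x" "y' = y" by (simp_all add: diffuse_def)
  with assms(2) show ?thesis by simp
qed

lemma INFM_Suc:
  assumes "\<exists>\<^sub>\<infinity>n. Q n"
  shows "\<exists>\<^sub>\<infinity>n. Q (Suc n)"
  using assms MOST_Suc_iff[of "\<lambda>n. \<not> Q n"] unfolding frequently_def by blast

lemma negative_diffusion_seq_iter:
  assumes fair: "\<And>i. \<exists>\<^sub>\<infinity>n. s n = i"
  shows "negative_diffusion P B (seq_hist P B s) (\<lambda>n. fst (seq_iter P B s n)) (\<lambda>n. {s (Suc n)})"
proof -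
  have balance: "fst (seq_iter P B s n) = B + P *v seq_hist P B s n - seq_hist P B s n" for n
  proof (induction n)
    case 0
    show ?case by (simp add: seq_hist_def)
  next
    case (Suc n)
    then show ?case
      unfolding seq_hist_def seq_iter.simps
      by (metis diffuse_fluid_balance prod.collapse)
  qed
  have step: "seq_hist P B s (Suc n) $ i = seq_hist P B s n $ i
      + (if i \<in> {s (Suc n)} then min 0 (fst (seq_iter P B s n) $ i) else 0)" for n i
    using snd_diffuse_nth[of P "s (Suc n)" "fst (seq_iter P B s n)" "snd (seq_iter P B s n)" i]
    by (simp add: seq_hist_def)
  have lim: "(\<lambda>n. fst (seq_iter P B s n)) \<longlonglongrightarrow> B + P *v L - L" if "seq_hist P B s \<longlonglongrightarrow> L" for L
    unfolding balance
    by (intro tendsto_intros that bounded_linear.tendsto[OF matrix_vector_mul_bounded_linear])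
  have "\<exists>\<^sub>\<infinity>n. i \<in> {s (Suc n)}" for i
    using INFM_Suc[OF fair[of i]] by (simp add: eq_commute)
  then show ?thesis
    unfolding negative_diffusion_def using step lim balance by (auto simp: seq_hist_def)
qed

section \<open>Messages with delays\<close>

text \<open>
  Here \<open>u\<close> is one component of the fluid that a sender has produced for the other processor, cut
  into increments at the times \<open>t'\<close>; the increment number \<open>l\<close> arrives at time \<open>t l\<close>, possibly out
  of order. As the increments are nonpositive, a set of increments has a larger sum than any finite
  superset. Comparing the increments received with the initial segment up to the last of them, which
  telescopes to a value of \<open>u\<close> at a time already past, gives the lower bound. A fixed initial
  segment is completely received from some time on, which gives the matching upper bound in the
  limit.
\<close>
lemma
  fixes u :: "nat \<Rightarrow> real" and t' t :: "nat \<Rightarrow> nat"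
  assumes t: "strict_mono t'" "t' 0 = 0" "\<And>n. n \<ge> 1 \<Longrightarrow> t' n \<le> t n"
    and u: "decseq u" "u 0 = 0"
  defines "R n \<equiv> \<Sum>l | 1 \<le> l \<and> t l \<le> n. u (t' l) - u (t' (l - 1))"
  shows received_increments_ge: "u n \<le> R n"
    and received_increments_tendsto: "u \<longlonglongrightarrow> c \<Longrightarrow> R \<longlonglongrightarrow> c"
proof -
  let ?A = "\<lambda>n. {l. 1 \<le> l \<and> t l \<le> n}"
  have "l \<le> n" if "l \<in> ?A n" for l n
    using that t(3)[of l] strict_mono_imp_increasing[OF t(1), of l] by auto
  then have "?A n \<subseteq> {..n}" for n by blast
  then have fin: "finite (?A n)" for n by (rule finite_subset) simp
  have telescope: "(\<Sum>l\<in>{1..M}. u (t' l) - u (t' (l - 1))) = u (t' M)" for M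
    by (induction M) (simp_all add: t u)
  have incr: "u (t' l) - u (t' (l - 1)) \<le> 0" for l
    using u(1) strict_mono_mono[OF t(1)] by (simp add: decseqD monoD)
  have more_is_less: "(\<Sum>l\<in>C. u (t' l) - u (t' (l - 1))) \<le> (\<Sum>l\<in>A. u (t' l) - u (t' (l - 1)))"
    if "finite C" "A \<subseteq> C" for A C
    using sum_mono2[OF that, of "\<lambda>l. - (u (t' l) - u (t' (l - 1)))"] incr
    by (simp only: sum_negf neg_le_iff_le neg_0_le_iff_le)
  show lower: "u n \<le> R n" for n
  proof (cases "?A n = {}")
    case True
    then have "R n = 0" by (simp only: R_def sum.empty)
    then show ?thesis using decseqD[OF u(1), of 0 n] u(2) by simp
  next
    case False
    define M where "M = Max (?A n)"
    have "M \<in> ?A n" unfolding M_def using fin False by (rule Max_in)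
    then have "t' M \<le> n" using t(3)[of M] by auto
    then have "u n \<le> u (t' M)" by (rule decseqD[OF u(1)])
    also have "\<dots> = (\<Sum>l\<in>{1..M}. u (t' l) - u (t' (l - 1)))" by (simp only: telescope)
    also have "\<dots> \<le> R n"
      unfolding R_def using fin[of n] by (intro more_is_less) (auto simp: M_def)
    finally show ?thesis .
  qed
  assume c: "u \<longlonglongrightarrow> c"
  show "R \<longlonglongrightarrow> c"
  proof (rule order_tendstoI)
    fix a assume "a < c"
    moreover have "c \<le> u n" for n using u(1) c by (rule decseq_ge)
    ultimately have "a < R n" for n using lower[of n] by (meson less_le_trans)
    then show "eventually (\<lambda>n. a < R n) sequentially" by simp
  next
    fix a assume "c < a"
    have "(u \<circ> t') \<longlonglongrightarrow> c" using c t(1) by (rule LIMSEQ_subseq_LIMSEQ)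
    then have "eventually (\<lambda>M. u (t' M) < a) sequentially"
      using \<open>c < a\<close> order_tendstoD(2) by fastforce
    then obtain M where M: "u (t' M) < a" by (auto simp: eventually_sequentially)
    show "eventually (\<lambda>n. R n < a) sequentially"
    proof (rule eventually_sequentiallyI)
      fix n assume n: "Max (t ` {..M}) \<le> n"
      then have "{1..M} \<subseteq> ?A n" by auto
      then have "R n \<le> (\<Sum>l\<in>{1..M}. u (t' l) - u (t' (l - 1)))"
        unfolding R_def by (intro more_is_less fin)
      also have "\<dots> < a" using M by (simp only: telescope)
      finally show "R n < a" .
    qed
  qed
qed

section \<open>The distributed iteration\<close>

lemma tendsto_vec_part:
  assumes "(g \<longlongrightarrow> L) net"
  shows "((\<lambda>x. vec_part S (g x)) \<longlongrightarrow> vec_part S L) net"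
proof (rule vec_tendstoI)
  fix i
  show "((\<lambda>x. vec_part S (g x) $ i) \<longlongrightarrow> vec_part S L $ i) net"
    using tendsto_vec_nth[OF assms, of i] by (cases "i \<in> S") (simp_all add: vec_part_def)
qed

lemma mat_block_mult_nth:
  assumes "i \<in> R"
  shows "(mat_block P R C *v x) $ i = (P *v vec_part C x) $ i"
  using assms
  by (auto simp: mat_block_def vec_part_def matrix_vector_mult_def intro!: sum.cong)

definition owner :: "(pid \<Rightarrow> 'n set) \<Rightarrow> 'n \<Rightarrow> pid" where
  "owner \<Omega> i = (if i \<in> \<Omega> PID1 then PID1 else PID2)"

lemma owner_iff:
  assumes "\<Omega> PID1 \<union> \<Omega> PID2 = UNIV" "\<Omega> PID1 \<inter> \<Omega> PID2 = {}"
  shows "i \<in> \<Omega> j \<longleftrightarrow> j = owner \<Omega> i"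
  using assms by (cases j) (auto simp: owner_def)

text \<open>
  A message is sent no earlier than its number, so only finitely many have arrived by time
  \<open>n\<close>. This matters since a sum over an infinite set would be zero by convention.
\<close>
lemma sum_received:
  assumes "transmission_times (T' j) (T j)"
  shows "(\<Sum>m\<le>n. received P \<Omega> T' T H j m)
    = (\<Sum>l | 1 \<le> l \<and> T j l \<le> n. message P \<Omega> T' H j l)"
proof -
  have "l \<le> n" if l: "1 \<le> l" "T j l \<le> n" for l
  proof -
    have "l \<le> T' j l"
      using assms by (intro strict_mono_imp_increasing) (simp add: transmission_times_def)
    also have "\<dots> \<le> T j l" using assms l(1) by (simp add: transmission_times_def)
    finally show ?thesis using l(2) by simp
  qed
  then have "{l. 1 \<le> l \<and> T j l \<le> n} \<subseteq> {..n}" by blast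
  then have "finite {l. 1 \<le> l \<and> T j l \<le> n}" by (rule finite_subset) simp
  then have "(\<Sum>m\<le>n. \<Sum>l\<in>{l \<in> {l. 1 \<le> l \<and> T j l \<le> n}. T j l = m}. message P \<Omega> T' H j l)
      = (\<Sum>l | 1 \<le> l \<and> T j l \<le> n. message P \<Omega> T' H j l)"
    by (intro sum.group) auto
  moreover have "{l \<in> {l. 1 \<le> l \<and> T j l \<le> n}. T j l = m} = {l. 1 \<le> l \<and> T j l = m}"
    if "m \<le> n" for m using that by auto
  ultimately show ?thesis by (simp add: received_def)
qed

lemma distributed_fluid_balance:
  assumes "distributed_iter P B \<Omega> T' T sel F H"
  shows "F j n = vec_part (\<Omega> j) B + (\<Sum>m<n. received P \<Omega> T' T H j m)
    + mat_block P (\<Omega> j) (\<Omega> j) *v H j n - H j n"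
proof (induction n)
  case 0
  show ?case using assms by (simp add: distributed_iter_def)
next
  case (Suc n)
  let ?F = "F j n + received P \<Omega> T' T H j n"
  have F: "?F = (vec_part (\<Omega> j) B + (\<Sum>m<Suc n. received P \<Omega> T' T H j m))
      + mat_block P (\<Omega> j) (\<Omega> j) *v H j n - H j n"
    using Suc by simp
  have step: "(F j (Suc n), H j (Suc n)) = (case sel j (Suc n) of None \<Rightarrow> (?F, H j n)
      | Some i \<Rightarrow> diffuse (mat_block P (\<Omega> j) (\<Omega> j)) i (?F, H j n))"
    using assms by (simp add: distributed_iter_def Let_def)
  show ?case
  proof (cases "sel j (Suc n)")
    case None
    with step F show ?thesis by simp
  next
    case (Some i)
    with step have "diffuse (mat_block P (\<Omega> j) (\<Omega> j)) i (?F, H j n) = (F j (Suc n), H j (Suc n))"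
      by simp
    from diffuse_fluid_balance[OF this F] show ?thesis .
  qed
qed

lemma distributed_history_step:
  assumes "distributed_iter P B \<Omega> T' T sel F H"
  shows "H j (Suc n) $ i = H j n $ i
    + (if sel j (Suc n) = Some i then min 0 ((F j n + received P \<Omega> T' T H j n) $ i) else 0)"
proof -
  let ?F = "F j n + received P \<Omega> T' T H j n"
  have step: "(F j (Suc n), H j (Suc n)) = (case sel j (Suc n) of None \<Rightarrow> (?F, H j n)
      | Some i \<Rightarrow> diffuse (mat_block P (\<Omega> j) (\<Omega> j)) i (?F, H j n))"
    using assms by (simp add: distributed_iter_def Let_def)
  show ?thesis
  proof (cases "sel j (Suc n)")
    case None
    with step show ?thesis by simp
  next
    case (Some k)
    with step have "H j (Suc n) = snd (diffuse (mat_block P (\<Omega> j) (\<Omega> j)) k (?F, H j n))"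
      by (metis option.simps(5) snd_conv)
    with Some show ?thesis by (simp only: snd_diffuse_nth) auto
  qed
qed

text \<open>
  The two local histories have disjoint supports and are glued to one global history \<open>h\<close>. At a
  node \<open>i\<close>, the fluid seen differs from the true residual only in the contribution of the other
  processor, where the sum of the increments received stands in place of the total \<open>u i n\<close>
  produced so far; the two facts on received increments thus give the inequality and the limit
  required of \<open>f\<close>.
\<close>
lemma negative_diffusion_distributed_iter:
  fixes P :: "real ^ 'n ^ 'n"
  assumes P: "\<And>i j. 0 \<le> P $ i $ j"
    and part: "\<Omega> PID1 \<union> \<Omega> PID2 = UNIV" "\<Omega> PID1 \<inter> \<Omega> PID2 = {}"
    and times: "\<And>j. transmission_times (T' j) (T j)"
    and sel_own: "\<And>j n i. n \<ge> 1 \<Longrightarrow> sel j n = Some i \<Longrightarrow> i \<in> \<Omega> j"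
    and sel_fair: "\<And>j i. i \<in> \<Omega> j \<Longrightarrow> \<exists>\<^sub>\<infinity>n. sel j n = Some i"
    and dist: "distributed_iter P B \<Omega> T' T sel F H"
  defines "h \<equiv> \<lambda>n. \<chi> i. H (owner \<Omega> i) n $ i"
    and "f \<equiv> \<lambda>n. \<chi> i. (F (owner \<Omega> i) n + received P \<Omega> T' T H (owner \<Omega> i) n) $ i"
  shows "negative_diffusion P B h f (\<lambda>n. {i. sel (owner \<Omega> i) (Suc n) = Some i})"
    and "H j n = vec_part (\<Omega> j) (h n)"
proof -
  note own = owner_iff[OF part]
  have init: "h 0 = 0"
    using dist by (simp add: h_def distributed_iter_def cart_eq_iff)
  have step: "h (Suc n) $ i = h n $ i
      + (if sel (owner \<Omega> i) (Suc n) = Some i then min 0 (f n $ i) else 0)" for n i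
    using distributed_history_step[OF dist] by (simp add: h_def f_def)
  have fair: "\<exists>\<^sub>\<infinity>n. sel (owner \<Omega> i) (Suc n) = Some i" for i
    using sel_fair[of i "owner \<Omega> i"] own by (intro INFM_Suc) simp
  have support: "H j n $ i = 0" if "i \<notin> \<Omega> j" for j n i
  proof (induction n)
    case 0
    show ?case using dist by (simp add: distributed_iter_def)
  next
    case (Suc n)
    moreover have "sel j (Suc n) \<noteq> Some i" using sel_own[of "Suc n" j i] that by auto
    ultimately show ?case by (simp add: distributed_history_step[OF dist])
  qed
  show part_h: "H j n = vec_part (\<Omega> j) (h n)" for j n
    using support own by (auto simp: cart_eq_iff vec_part_def h_def)
  have dec: "decseq h"
    by (rule decseq_SucI) (auto simp: step cart_le_def)
  \<comment> \<open>The fluid that the other processor has produced for node \<open>i\<close> up to time \<open>n\<close>, sent or not.\<close>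
  define u where "u i n = (P *v vec_part (\<Omega> (other (owner \<Omega> i))) (h n)) $ i" for i n
  have u: "decseq (u i)" "u i 0 = 0" for i
  proof -
    show "decseq (u i)"
    proof (rule decseq_SucI)
      fix n
      have "vec_part S (h (Suc n)) \<le> vec_part S (h n)" for S
        using decseq_SucD[OF dec, of n] by (simp add: vec_part_def cart_le_def)
      from nonneg_matrix_vector_mono[OF P this] show "u i (Suc n) \<le> u i n"
        by (simp add: u_def cart_le_def)
    qed
    have "vec_part S 0 = 0" for S :: "'n set" by (simp add: vec_part_def cart_eq_iff)
    then show "u i 0 = 0" by (simp add: u_def init)
  qed
  \<comment> \<open>The part of it that has been received when step \<open>n + 1\<close> is made.\<close>
  define R where "R i n = (\<Sum>l | 1 \<le> l \<and> T (owner \<Omega> i) l \<le> n.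
    u i (T' (owner \<Omega> i) l) - u i (T' (owner \<Omega> i) (l - 1)))" for i n
  have split: "(P *v vec_part (\<Omega> (owner \<Omega> i)) x) $ i + (P *v vec_part (\<Omega> (other (owner \<Omega> i))) x) $ i
      = (P *v x) $ i" for i x
  proof -
    have "vec_part (\<Omega> (owner \<Omega> i)) x + vec_part (\<Omega> (other (owner \<Omega> i))) x = x"
      using part by (cases "owner \<Omega> i") (auto simp: vec_part_def cart_eq_iff)
    then show ?thesis
      by (metis matrix_vector_right_distrib vector_add_component)
  qed
  have f: "f n $ i = B $ i + R i n + (P *v vec_part (\<Omega> (owner \<Omega> i)) (h n)) $ i - h n $ i" for n i
  proof -
    let ?j = "owner \<Omega> i"
    have i: "i \<in> \<Omega> ?j" using own by simp
    have "(\<Sum>m\<le>n. received P \<Omega> T' T H ?j m) $ i = R i n"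
      unfolding sum_received[of T' ?j T, OF times] R_def u_def
      by (simp add: message_def matrix_vector_mult_diff_distrib mat_block_mult_nth[OF i]
          part_h[symmetric])
         (simp add: part_h vec_part_def if_distrib cong: if_cong)
    moreover have "f n $ i = (vec_part (\<Omega> ?j) B + (\<Sum>m\<le>n. received P \<Omega> T' T H ?j m)
        + mat_block P (\<Omega> ?j) (\<Omega> ?j) *v H ?j n - H ?j n) $ i"
      using distributed_fluid_balance[OF dist, of ?j n]
      by (simp add: f_def lessThan_Suc_atMost[symmetric])
    ultimately show ?thesis
      using i by (simp add: mat_block_mult_nth part_h) (simp add: vec_part_def if_distrib cong: if_cong)
  qed
  have times': "strict_mono (T' k)" "T' k 0 = 0" "\<And>n. n \<ge> 1 \<Longrightarrow> T' k n \<le> T k n" for k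
    using times[of k] by (auto simp: transmission_times_def)
  have "B + P *v h n - h n \<le> f n" for n
    unfolding cart_le_def
  proof
    fix i
    have "u i n \<le> R i n"
      unfolding R_def by (rule received_increments_ge[OF times' u])
    then show "(B + P *v h n - h n) $ i \<le> f n $ i"
      unfolding f using split[of i "h n"] by (simp add: u_def)
  qed
  moreover have "f \<longlonglongrightarrow> B + P *v L - L" if L: "h \<longlonglongrightarrow> L" for L
  proof (rule vec_tendstoI)
    fix i
    have vp: "(\<lambda>n. vec_part S (h n)) \<longlonglongrightarrow> vec_part S L" for S
      using L by (rule tendsto_vec_part)
    have Pvp: "(\<lambda>n. (P *v vec_part S (h n)) $ i) \<longlonglongrightarrow> (P *v vec_part S L) $ i" for S
      by (intro tendsto_vec_nth bounded_linear.tendsto[OF matrix_vector_mul_bounded_linear] vp)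
    then have "u i \<longlonglongrightarrow> (P *v vec_part (\<Omega> (other (owner \<Omega> i))) L) $ i"
      by (simp add: u_def[abs_def])
    then have "R i \<longlonglongrightarrow> (P *v vec_part (\<Omega> (other (owner \<Omega> i))) L) $ i"
      using received_increments_tendsto[OF times'(1,2) times'(3)[of _ "owner \<Omega> i"] u[of i]]
      unfolding R_def[abs_def] by blast
    then have "(\<lambda>n. f n $ i) \<longlonglongrightarrow> B $ i + (P *v vec_part (\<Omega> (other (owner \<Omega> i))) L) $ i
        + (P *v vec_part (\<Omega> (owner \<Omega> i)) L) $ i - L $ i"
      unfolding f by (intro tendsto_intros Pvp tendsto_vec_nth[OF L])
    then show "(\<lambda>n. f n $ i) \<longlonglongrightarrow> (B + P *v L - L) $ i"
      using split[of i L] by (simp add: algebra_simps)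
  qed
  ultimately show "negative_diffusion P B h f (\<lambda>n. {i. sel (owner \<Omega> i) (Suc n) = Some i})"
    unfolding negative_diffusion_def using init step fair by auto
qed

theorem theorem17:
  fixes P :: "real ^ 'n ^ 'n" and V B Hlim :: "real ^ 'n"
    and s :: "nat \<Rightarrow> 'n"
    and \<Omega> :: "pid \<Rightarrow> 'n set"
    and T' T :: "pid \<Rightarrow> nat \<Rightarrow> nat"
    and sel :: "pid \<Rightarrow> nat \<Rightarrow> 'n option"
    and F H :: "pid \<Rightarrow> nat \<Rightarrow> real ^ 'n"
    and Tmax :: real
  assumes P_nonneg: "\<And>i j. P $ i $ j \<ge> 0"
    and P_rho: "spec_rad P = 1"
    and V_pos: "\<And>i. V $ i > 0"
    and V_left: "V v* P = V"
    and B_sum: "(\<Sum>i\<in>UNIV. V $ i * B $ i) = 0"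
    and seq_fair: "\<And>i. \<exists>\<^sub>\<infinity>n. s n = i"
    and seq_lim: "(\<lambda>n. seq_hist P B s n) \<longlonglongrightarrow> Hlim"
    and part: "\<Omega> PID1 \<union> \<Omega> PID2 = UNIV" "\<Omega> PID1 \<inter> \<Omega> PID2 = {}"
    and times: "\<And>j. transmission_times (T' j) (T j)"
    and sel_own: "\<And>j n i. n \<ge> 1 \<Longrightarrow> sel j n = Some i \<Longrightarrow> i \<in> \<Omega> j"
    and sel_fair: "\<And>j i. i \<in> \<Omega> j \<Longrightarrow> \<exists>\<^sub>\<infinity>n. sel j n = Some i"
    and dist: "distributed_iter P B \<Omega> T' T sel F H"
    and delay: "\<And>j n. n \<ge> 1 \<Longrightarrow> \<bar>real (T j n) - real (T' j n)\<bar> \<le> Tmax"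
    and gap: "\<And>j n. n \<ge> 1 \<Longrightarrow> \<bar>real (T' j n) - real (T' j (n - 1))\<bar> \<le> Tmax"
  shows "H PID1 \<longlonglongrightarrow> vec_part (\<Omega> PID1) Hlim \<and> H PID2 \<longlonglongrightarrow> vec_part (\<Omega> PID2) Hlim"
proof -
  define h where "h = (\<lambda>n. \<chi> i. H (owner \<Omega> i) n $ i)"
  note distributed =
    negative_diffusion_distributed_iter[OF P_nonneg part times sel_own sel_fair dist]
  have "h \<longlonglongrightarrow> Hlim"
    unfolding h_def
    using negative_diffusion_limit_unique[OF P_nonneg
        negative_diffusion_seq_iter[OF seq_fair] seq_lim distributed(1)] .
  then have "(\<lambda>n. vec_part S (h n)) \<longlonglongrightarrow> vec_part S Hlim" for S
    by (rule tendsto_vec_part)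
  moreover have "H j = (\<lambda>n. vec_part (\<Omega> j) (h n))" for j
    unfolding h_def by (rule ext) (rule distributed(2))
  ultimately show ?thesis by simp
qed

end
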